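(* Maps without a Hamiltonian cycle have no upper bound on their total number of faces, of edges, of vertices, or on the maximal number of vertices of a single face. That is, for every natural number $N$ and for each of these four quantities there exists a map without a Hamiltonian cycle, together with an embedding of it in the plane, for which this quantity is greater than $N$.
   Context: "Graph" means a finite connected undirected graph without loops, multiple edges, or vertices of degree one. A map is a finite planar graph that is regular of degree three and has no isthmi (bridges). Faces are those of an embedding of the map in the plane, including the unbounded face; each face is bounded by an elementary cycle, and the number of vertices of a face is the length of that cycle. *)

theory Defs
  imports "HOL-Analysis.Analysis" "Graph_Theory.Digraph_Component"
begin

(* An undirected simple graph is a pair_graph: a finite, symmetric, loop-free set of ordered
   pairs.  An undirected edge {u,v} is thus represented by the two arcs (u,v) and (v,u). *)

definition connected_simple_graph :: "'a pair_pre_digraph \<Rightarrow> bool" where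
  "connected_simple_graph G \<longleftrightarrow>
     pair_graph G \<and> Digraph_Component.connected (with_proj G) \<and>
     (\<forall>v\<in>pverts G. out_degree (with_proj G) v \<noteq> 1)"

definition edges :: "'a pair_pre_digraph \<Rightarrow> 'a set set" where
  "edges G = (\<lambda>(u, v). {u, v}) ` parcs G"

definition del_edge :: "'a pair_pre_digraph \<Rightarrow> 'a \<Rightarrow> 'a \<Rightarrow> 'a pair_pre_digraph" where
  "del_edge G u v = \<lparr> pverts = pverts G, parcs = parcs G - {(u, v), (v, u)} \<rparr>"

definition isthmus :: "'a pair_pre_digraph \<Rightarrow> 'a \<Rightarrow> 'a \<Rightarrow> bool" where
  "isthmus G u v \<longleftrightarrow>
     (u, v) \<in> parcs G \<and> \<not> Digraph_Component.connected (with_proj (del_edge G u v))"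

(* The library's notion of cycle is the one for digraphs, for which (u,v),(v,u) is a cycle;
   the bound on the length excludes traversing one undirected edge back and forth. *)

definition elementary_cycle :: "'a pair_pre_digraph \<Rightarrow> ('a \<times> 'a) list \<Rightarrow> bool" where
  "elementary_cycle G p \<longleftrightarrow> pre_digraph.cycle (with_proj G) p \<and> 3 \<le> length p"

definition hamiltonian_cycle :: "'a pair_pre_digraph \<Rightarrow> ('a \<times> 'a) list \<Rightarrow> bool" where
  "hamiltonian_cycle G p \<longleftrightarrow> elementary_cycle G p \<and> fst ` set p = pverts G"

(* The vertices are drawn as the points given by pos, and the edge with arcs (u,v), (v,u) as the
   Jordan arc \<gamma> (u,v), the curve \<gamma> (v,u) having the same image.  The plane is the type complex. *)

definition plane_embedding ::
  "'a pair_pre_digraph \<Rightarrow> ('a \<Rightarrow> complex) \<Rightarrow> ('a \<times> 'a \<Rightarrow> real \<Rightarrow> complex) \<Rightarrow> bool" where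
  "plane_embedding G pos \<gamma> \<longleftrightarrow>
     inj_on pos (pverts G) \<and>
     (\<forall>(u, v)\<in>parcs G.
        arc (\<gamma> (u, v)) \<and> pathstart (\<gamma> (u, v)) = pos u \<and> pathfinish (\<gamma> (u, v)) = pos v \<and>
        path_image (\<gamma> (v, u)) = path_image (\<gamma> (u, v)) \<and>
        path_image (\<gamma> (u, v)) \<inter> pos ` pverts G = {pos u, pos v}) \<and>
     (\<forall>e\<in>parcs G. \<forall>f\<in>parcs G. f \<noteq> e \<and> f \<noteq> prod.swap e \<longrightarrow>
        path_image (\<gamma> e) \<inter> path_image (\<gamma> f) \<subseteq> pos ` pverts G)"

definition planar :: "'a pair_pre_digraph \<Rightarrow> bool" where
  "planar G \<longleftrightarrow> (\<exists>pos \<gamma>. plane_embedding G pos \<gamma>)"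

definition planar_map :: "'a pair_pre_digraph \<Rightarrow> bool" where
  "planar_map G \<longleftrightarrow>
     connected_simple_graph G \<and> planar G \<and>
     (\<forall>v\<in>pverts G. out_degree (with_proj G) v = 3) \<and>
     (\<forall>u v. \<not> isthmus G u v)"

definition faces ::
  "'a pair_pre_digraph \<Rightarrow> ('a \<Rightarrow> complex) \<Rightarrow> ('a \<times> 'a \<Rightarrow> real \<Rightarrow> complex) \<Rightarrow> complex set set" where
  "faces G pos \<gamma> = components (- (pos ` pverts G \<union> (\<Union>e\<in>parcs G. path_image (\<gamma> e))))"

definition bounds_face ::
  "'a pair_pre_digraph \<Rightarrow> ('a \<times> 'a \<Rightarrow> real \<Rightarrow> complex) \<Rightarrow> ('a \<times> 'a) list \<Rightarrow> complex set \<Rightarrow> bool" where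
  "bounds_face G \<gamma> p F \<longleftrightarrow>
     elementary_cycle G p \<and> frontier F = (\<Union>e\<in>set p. path_image (\<gamma> e))"

(* The number of vertices of a face is the length of an elementary cycle bounding it. *)

definition max_face_vertices ::
  "'a pair_pre_digraph \<Rightarrow> ('a \<Rightarrow> complex) \<Rightarrow> ('a \<times> 'a \<Rightarrow> real \<Rightarrow> complex) \<Rightarrow> nat" where
  "max_face_vertices G pos \<gamma> =
     Max {length p | p F. F \<in> faces G pos \<gamma> \<and> bounds_face G \<gamma> p F}"

end

theory Submission
  imports Defs
begin

text \<open>
  A cubic graph that falls apart into three pieces when two vertices \<open>a\<close> and \<open>b\<close> are
  removed has no Hamiltonian cycle: the cycle has to leave each piece, every exit of a piece leads to
  \<open>a\<close> or \<open>b\<close>, and a cycle enters each of these two vertices only once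
  (\<open>no_hamiltonian_cycle_many_parts\<close>). So two vertices can be joined by three arbitrarily long chains,
  and the result grows without bound in every respect. It remains to choose the chains so that
  the graph is a map, and to have a drawing in which faces can be counted and measured.

  Each chain is a ladder whose two ends are closed by a vertex joined to both rails; these six end
  vertices are joined to \<open>a\<close> on the left and to \<open>b\<close> on the right. The graph is drawn with straight
  segments on an integer grid of width \<open>L\<close>, so that every edge is either vertical or spans the gap
  between two consecutive columns. This layering reduces most of the work to finite checks:

  \<^item> Two edges over the same gap keep their vertical order (\<open>step_mono\<close>) and edges over different gaps
    meet at most in a column, whence the drawing is plane (\<open>plane_embedding\<close>).
  \<^item> After the deletion of an edge, every vertex still gets to \<open>a\<close> by walking left or to \<open>b\<close> by walking
    right, and a chain that avoids the edge joins \<open>a\<close> to \<open>b\<close>; so no edge is an isthmus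
    (\<open>connected_del_edge\<close>).
  \<^item> The cells of the middle ladder are open rectangles disjoint from the drawing with frontier in
    it, hence faces; that there are only finitely many faces holds for every drawing with straight
    segments (\<open>finite_components_complement\<close>).
  \<^item> The outline of the drawing is a convex polygon, so the unbounded face is the complement of a
    compact convex set, bounded by a cycle of length \<open>2 * L\<close> (\<open>outer_face\<close>, \<open>path_image_rim\<close>).
\<close>

section \<open>Complements of closed sets and segments\<close>

text \<open>
  The components are open and hyperplanes are negligible, so each component contains a point on none
  of the hyperplanes. The sides on which this point lies determine a convex cell of the hyperplane
  arrangement, which lies in a single component. Hence there are at most as many components as
  ways to choose sides.\<close>
lemma finite_components_complement:
  fixes A :: "('a::euclidean_space \<times> real) set"
  assumes A: "finite A" "\<And>a b. (a, b) \<in> A \<Longrightarrow> a \<noteq> 0"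
    and D: "closed D" "D \<subseteq> (\<Union>(a, b)\<in>A. {z. a \<bullet> z = b})"
  shows "finite (components (- D))"
proof -
  let ?H = "\<Union>(a, b)\<in>A. {z. a \<bullet> z = b}"
  have "negligible ?H"
    using A by (intro negligible_Union finite_imageI) (auto intro!: negligible_hyperplane dest!: A(2))
  have generic: "\<exists>z. z \<in> C \<and> z \<notin> ?H" if C: "C \<in> components (- D)" for C
  proof -
    have "open C" "C \<noteq> {}"
      using C D in_components_nonempty[OF C] by (auto intro: open_components)
    then have "\<not> negligible C"
      by (rule open_not_negligible)
    then show ?thesis
      using \<open>negligible ?H\<close> negligible_subset by blast
  qed
  then obtain z where z: "z C \<in> C" "z C \<notin> ?H" if "C \<in> components (- D)" for C
    by metis
  define side where "side C = {(a, b) \<in> A. a \<bullet> z C < b}" for C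
  have "inj_on side (components (- D))"
  proof (rule inj_onI)
    fix C C' assume C: "C \<in> components (- D)" "C' \<in> components (- D)" and eq: "side C = side C'"
    \<comment> \<open>the cell of the arrangement that contains both chosen points\<close>
    define K where "K = (\<Inter>(a, b)\<in>A. if (a, b) \<in> side C then {z. a \<bullet> z < b} else {z. a \<bullet> z > b})"
    have "convex K"
      unfolding K_def by (intro convex_INT) (auto simp: convex_halfspace_lt convex_halfspace_gt)
    have "K \<subseteq> - D"
      using D(2) by (fastforce simp: K_def split: if_splits)
    have "z C'' \<in> K" if "C'' \<in> components (- D)" "side C'' = side C" for C''
      using z[OF that(1)] that(2)[symmetric] by (fastforce simp: K_def side_def)
    then have zK: "z C \<in> K" "z C' \<in> K"
      using C eq by auto
    have "K \<subseteq> C" "K \<subseteq> C'"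
      using components_maximal[OF _ convex_connected[OF \<open>convex K\<close>] \<open>K \<subseteq> - D\<close>] C zK z by blast+
    then show "C = C'"
      using components_eq[OF C] zK by blast
  qed
  moreover have "side ` components (- D) \<subseteq> Pow A"
    by (auto simp: side_def)
  ultimately show ?thesis
    using A(1) by (meson finite_Pow_iff inj_on_finite)
qed

lemma in_components_complementI:
  fixes C :: "'a::topological_space set"
  assumes "topological_space_class.connected C" "C \<noteq> {}" "C \<inter> D = {}" "frontier C \<subseteq> D"
  shows "C \<in> components (- D)"
proof -
  have "E = C" if "C \<subseteq> E" "E \<subseteq> - D" "topological_space_class.connected E" for E
    using connected_Int_frontier[OF that(3), of C] that assms by blast
  then show ?thesis
    using assms by (auto simp: in_components_maximal)
qed

lemma closed_segment_unit_width:
  fixes a b x :: real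
  shows "closed_segment (Complex x a) (Complex (x + 1) b) =
    {z. x \<le> Re z \<and> Re z \<le> x + 1 \<and> Im z = a + (Re z - x) * (b - a)}"
proof (intro set_eqI iffI)
  fix z assume "z \<in> closed_segment (Complex x a) (Complex (x + 1) b)"
  then obtain t where t: "0 \<le> t" "t \<le> 1" and z: "z = (1 - t) *\<^sub>R Complex x a + t *\<^sub>R Complex (x + 1) b"
    by (auto simp: in_segment)
  have "Re z = x + t" "Im z = a + t * (b - a)"
    by (simp_all add: z algebra_simps)
  then show "z \<in> {z. x \<le> Re z \<and> Re z \<le> x + 1 \<and> Im z = a + (Re z - x) * (b - a)}"
    using t by simp
next
  fix z assume "z \<in> {z. x \<le> Re z \<and> Re z \<le> x + 1 \<and> Im z = a + (Re z - x) * (b - a)}"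
  then show "z \<in> closed_segment (Complex x a) (Complex (x + 1) b)"
    by (auto simp: in_segment complex_eq_iff algebra_simps intro!: exI[of _ "Re z - x"])
qed

lemma closed_segment_subset_hyperplane:
  fixes u v :: complex
  shows "closed_segment u v \<subseteq> {z. (\<i> * (v - u)) \<bullet> z = (\<i> * (v - u)) \<bullet> u}"
proof
  fix z assume "z \<in> closed_segment u v"
  then obtain t where z: "z = (1 - t) *\<^sub>R u + t *\<^sub>R v"
    by (auto simp: in_segment)
  show "z \<in> {z. (\<i> * (v - u)) \<bullet> z = (\<i> * (v - u)) \<bullet> u}"
    by (simp add: z inner_complex_def algebra_simps)
qed

section \<open>Connectedness and cycles in graphs\<close>

text \<open>
  Reachability from everywhere to a single vertex suffices, because symmetry lets the walks be reversed.\<close>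
lemma connected_if_all_reach:
  assumes "r \<in> pverts G" "sym (parcs G)" "parcs G \<subseteq> pverts G \<times> pverts G"
    and "\<And>v. v \<in> pverts G \<Longrightarrow> (v, r) \<in> (parcs G)\<^sup>*"
  shows "Digraph_Component.connected (with_proj G)"
proof -
  have sub: "parcs G \<subseteq> (parcs G)\<^sup>s"
    by (auto simp: symcl_def)
  have "(u, v) \<in> rtrancl_on (pverts G) ((parcs G)\<^sup>s)" if "u \<in> pverts G" "v \<in> pverts G" for u v
  proof -
    have "(u, r) \<in> (parcs G)\<^sup>*" "(r, v) \<in> (parcs G)\<^sup>*"
      using assms that symD[OF sym_rtrancl] by metis+
    then have "(u, v) \<in> (parcs G)\<^sup>*" by (rule rtrancl_trans)
    then show ?thesis
      using that(1)
    proof (induction rule: rtrancl_induct)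
      case base
      then show ?case by simp
    next
      case (step y w)
      then show ?case
        using sub assms(3) by (blast intro: rtrancl_on_into_rtrancl_on)
    qed
  qed
  then show ?thesis
    using assms(1) by (auto simp: connected_conv)
qed

lemma pcas_append: "pcas u (p @ q) v \<longleftrightarrow> (\<exists>w. pcas u p w \<and> pcas w q v)"
  by (induction p arbitrary: u) auto

lemma walk_exits:
  assumes "pcas u p v" "u \<in> S" "v \<notin> S"
  shows "\<exists>e\<in>set p. fst e \<in> S \<and> snd e \<notin> S"
  using assms
proof (induction p arbitrary: u)
  case (Cons e p)
  then show ?case
    by (cases "snd e \<in> S") auto
qed simp

lemma closed_walk_exits:
  assumes "pcas u p u" "x \<in> fst ` set p" "y \<in> fst ` set p" "x \<in> S" "y \<notin> S"
  shows "\<exists>e\<in>set p. fst e \<in> S \<and> snd e \<notin> S"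
proof (cases "u \<in> S")
  case True
  obtain e where "e \<in> set p" "fst e = y"
    using assms(3) by blast
  then obtain p1 p2 where "p = p1 @ e # p2"
    by (meson split_list)
  with assms(1) \<open>fst e = y\<close> have "pcas u p1 y"
    by (auto simp: pcas_append)
  then show ?thesis
    using walk_exits[of u p1 y S] True assms(5) \<open>p = _\<close> by auto
next
  case False
  obtain e where "e \<in> set p" "fst e = x"
    using assms(2) by blast
  then obtain p1 p2 where p: "p = p1 @ e # p2"
    by (meson split_list)
  with assms(1) \<open>fst e = x\<close> have "pcas x (e # p2) u"
    by (auto simp: pcas_append)
  then show ?thesis
    using walk_exits[of x "e # p2" u S] False assms(4) p by auto
qed

text \<open>
  Since a closed walk begins where it ends, listing its vertices without the first one amounts
  to listing the heads of its arcs.\<close>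
lemma elementary_cycle_iff:
  "elementary_cycle G p \<longleftrightarrow>
    (\<exists>u\<in>pverts G. pcas u p u) \<and> set p \<subseteq> parcs G \<and> distinct (map snd p) \<and> 3 \<le> length p"
proof -
  have "tl (pre_digraph.awalk_verts (with_proj G) u p) = map snd p" if "pcas u p u" "p \<noteq> []" for u
    using that by (subst pre_digraph.awalk_verts_conv') (auto simp: cas_with_proj_eq)
  then show ?thesis
    by (cases "p = []")
      (auto simp: elementary_cycle_def pre_digraph.cycle_def pre_digraph.awalk_def cas_with_proj_eq)
qed

text \<open>
  The arcs by which the cycle leaves the different parts are different, hence so are their
  heads; but the heads lie in \<open>T\<close>, which has fewer elements than there are parts.\<close>
lemma no_hamiltonian_cycle_many_parts:
  assumes fin: "finite T" "card T < card I"
    and T: "T \<inter> \<Union>(S ` I) = {}" "T \<subseteq> pverts G" "T \<noteq> {}"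
    and S: "\<And>i. i \<in> I \<Longrightarrow> S i \<inter> pverts G \<noteq> {}" "disjoint_family_on S I"
    and exits: "\<And>i u v. i \<in> I \<Longrightarrow> (u, v) \<in> parcs G \<Longrightarrow> u \<in> S i \<Longrightarrow> v \<notin> S i \<Longrightarrow> v \<in> T"
  shows "\<not> hamiltonian_cycle G p"
proof
  assume "hamiltonian_cycle G p"
  then obtain u where u: "pcas u p u" "set p \<subseteq> parcs G" "distinct (map snd p)"
    and cover: "fst ` set p = pverts G"
    by (auto simp: hamiltonian_cycle_def elementary_cycle_iff)
  have "\<exists>e. e \<in> set p \<and> fst e \<in> S i \<and> snd e \<in> T" if i: "i \<in> I" for i
  proof -
    obtain x y where "x \<in> S i" "x \<in> pverts G" "y \<in> T"
      using S(1)[OF i] T(3) by blast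
    then have "\<exists>e\<in>set p. fst e \<in> S i \<and> snd e \<notin> S i"
      using T i by (intro closed_walk_exits[OF u(1), of x y]) (auto simp: cover)
    then show ?thesis
      using exits[OF i] u(2) by fastforce
  qed
  then obtain e where e: "\<And>i. i \<in> I \<Longrightarrow> e i \<in> set p" "\<And>i. i \<in> I \<Longrightarrow> fst (e i) \<in> S i"
      "\<And>i. i \<in> I \<Longrightarrow> snd (e i) \<in> T"
    by metis
  have "inj_on (snd \<circ> e) I"
  proof (rule inj_onI)
    fix i j assume ij: "i \<in> I" "j \<in> I" "(snd \<circ> e) i = (snd \<circ> e) j"
    then have "e i = e j"
      using u(3) e(1) by (auto simp: distinct_map inj_on_def)
    then show "i = j"
      using e(2)[OF ij(1)] e(2)[OF ij(2)] S(2) ij by (auto simp: disjoint_family_on_def)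
  qed
  moreover have "(snd \<circ> e) ` I \<subseteq> T"
    using e(3) by auto
  ultimately show False
    using fin by (metis card_inj_on_le not_le)
qed

section \<open>Three ladders between two vertices\<close>

text \<open>
  The vertices sit in columns \<open>0, \<dots>, L\<close> and rows \<open>0, \<dots>, 8\<close>. Columns \<open>0\<close> and \<open>L\<close> hold the two
  terminals, columns \<open>1\<close> and \<open>L - 1\<close> the ends of the ladders, and the columns between them the rails in
  rows \<open>0, 2\<close>, rows \<open>3, 5\<close> and rows \<open>6, 8\<close>. The rows are chosen such that \<open>y div 3\<close> tells for all
  vertices but the terminals to which of the three chains they belong, and such that the
  outline of the drawing is convex. The bound \<open>5 \<le> L\<close> gives each ladder at least two rungs.\<close>
locale three_ladders =
  fixes L :: nat
  assumes L: "5 \<le> L"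
begin

definition node :: "nat \<Rightarrow> nat \<Rightarrow> bool" where
  "node k y \<longleftrightarrow>
     (k = 0 \<or> k = L) \<and> y = 4 \<or>
     (k = 1 \<or> Suc k = L) \<and> y \<in> {2, 4, 6} \<or>
     2 \<le> k \<and> k + 2 \<le> L \<and> y \<in> {0, 2, 3, 5, 6, 8}"

text \<open>
  How the end vertices of the ladders are joined to the rails, as pairs of rows.\<close>
definition fork :: "(nat \<times> nat) set" where
  "fork = {(2, 0), (2, 2), (4, 3), (4, 5), (6, 6), (6, 8)}"

text \<open>
  In the order of the disjuncts, from left to right in the drawing: the edges at the left terminal,
  the left ends of the ladders, the rails, and the mirror images of the second and the first kind.\<close>
definition step :: "nat \<Rightarrow> nat \<Rightarrow> nat \<Rightarrow> bool" where
  "step k y y' \<longleftrightarrow>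
     k = 0 \<and> y = 4 \<and> y' \<in> {2, 4, 6} \<or>
     k = 1 \<and> (y, y') \<in> fork \<or>
     2 \<le> k \<and> k + 3 \<le> L \<and> y = y' \<and> y \<in> {0, 2, 3, 5, 6, 8} \<or>
     k + 2 = L \<and> (y', y) \<in> fork \<or>
     Suc k = L \<and> y \<in> {2, 4, 6} \<and> y' = 4"

definition rung :: "nat \<Rightarrow> nat \<Rightarrow> nat \<Rightarrow> bool" where
  "rung k y y' \<longleftrightarrow> 2 \<le> k \<and> k + 2 \<le> L \<and>
     (y, y') \<in> {(0, 2), (2, 0), (3, 5), (5, 3), (6, 8), (8, 6)}"

definition adj :: "nat \<Rightarrow> nat \<Rightarrow> nat \<Rightarrow> nat \<Rightarrow> bool" where
  "adj k y k' y' \<longleftrightarrow>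
     k' = Suc k \<and> step k y y' \<or> k = Suc k' \<and> step k' y' y \<or> k' = k \<and> rung k y y'"

definition vtx :: "nat \<Rightarrow> nat \<Rightarrow> nat" where
  "vtx k y = prod_encode (k, y)"

definition graph :: "nat pair_pre_digraph" where
  "graph = \<lparr>pverts = {vtx k y | k y. node k y},
            parcs = {(vtx k y, vtx k' y') | k y k' y'. adj k y k' y'}\<rparr>"

lemma vtx_eq_iff [simp]: "vtx k y = vtx k' y' \<longleftrightarrow> k = k' \<and> y = y'"
  by (simp add: vtx_def)

lemma node_cases [consumes 1, case_names first second ladder penultimate last]:
  assumes "node k y"
  obtains "k = 0" "y = 4" | "k = 1" "y \<in> {2, 4, 6}"
    | "2 \<le> k" "k + 2 \<le> L" "y \<in> {0, 2, 3, 5, 6, 8}"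
    | "Suc k = L" "y \<in> {2, 4, 6}" | "k = L" "y = 4"
  using assms by (auto simp: node_def)

lemma step_cases [consumes 1, case_names first fork rail join last]:
  assumes "step k y y'"
  obtains "k = 0" "y = 4" "y' \<in> {2, 4, 6}" | "k = 1" "(y, y') \<in> fork"
    | "2 \<le> k" "k + 3 \<le> L" "y = y'" "y \<in> {0, 2, 3, 5, 6, 8}"
    | "k + 2 = L" "(y', y) \<in> fork" | "Suc k = L" "y \<in> {2, 4, 6}" "y' = 4"
  using assms by (auto simp: step_def)

lemma step_node:
  assumes "step k y y'"
  shows "node k y \<and> node (Suc k) y'"
  using assms by (cases rule: step_cases) (use L in \<open>auto simp: node_def fork_def\<close>)

lemma rung_node: "rung k y y' \<Longrightarrow> node k y \<and> node k y'"
  by (auto simp: rung_def node_def)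

lemma step_iff:
  "step 0 y y' \<longleftrightarrow> y = 4 \<and> y' \<in> {2, 4, 6}"
  "step (Suc 0) y y' \<longleftrightarrow> (y, y') \<in> fork"
  "2 \<le> k \<Longrightarrow> k + 3 \<le> L \<Longrightarrow> step k y y' \<longleftrightarrow> y = y' \<and> y \<in> {0, 2, 3, 5, 6, 8}"
  "k + 2 = L \<Longrightarrow> step k y y' \<longleftrightarrow> (y', y) \<in> fork"
  "Suc k = L \<Longrightarrow> step k y y' \<longleftrightarrow> y \<in> {2, 4, 6} \<and> y' = 4"
  "L \<le> k \<Longrightarrow> \<not> step k y y'"
  using L by (auto simp: step_def)

lemma adj_sym: "adj k y k' y' \<Longrightarrow> adj k' y' k y"
  by (auto simp: adj_def rung_def)

lemma adj_node: "adj k y k' y' \<Longrightarrow> node k y \<and> node k' y'"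
  using step_node rung_node by (auto simp: adj_def)

lemma node_le: "node k y \<Longrightarrow> k \<le> L" and node_row: "node k y \<Longrightarrow> y \<le> 8"
  using L by (auto simp: node_def)

lemma vtx_in_pverts [simp]: "vtx k y \<in> pverts graph \<longleftrightarrow> node k y"
  by (auto simp: graph_def)

lemma vtx_in_parcs [simp]: "(vtx k y, vtx k' y') \<in> parcs graph \<longleftrightarrow> adj k y k' y'"
  by (auto simp: graph_def)

lemma finite_pverts: "finite (pverts graph)"
proof -
  have "pverts graph \<subseteq> (\<lambda>(k, y). vtx k y) ` ({..L} \<times> {..8})"
    using node_le node_row by (auto simp: graph_def)
  then show ?thesis
    by (rule finite_subset) auto
qed

lemma parcs_subset: "parcs graph \<subseteq> pverts graph \<times> pverts graph"
  using adj_node by (auto simp: graph_def)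

lemma finite_parcs: "finite (parcs graph)"
  using parcs_subset finite_pverts by (meson finite_SigmaI finite_subset)

lemma sym_parcs: "sym (parcs graph)"
  using adj_sym by (fastforce simp: graph_def sym_def)

lemma pair_graph: "pair_graph graph"
proof
  show "e \<in> parcs graph \<Longrightarrow> fst e \<noteq> snd e" for e
    by (auto simp: graph_def adj_def rung_def)
  show "symmetric (with_proj graph)"
    using sym_parcs by (simp add: symmetric_def)
qed (use parcs_subset finite_pverts finite_parcs in auto)

section \<open>Degrees\<close>

lemma card_right:
  assumes "node k y"
  shows "card {y'. step k y y'} = (if k = 0 then 3 else if k = 1 then 2 else if k < L then 1 else 0)"
  using assms
proof (cases rule: node_cases)
  case ladder
  then consider "k + 3 \<le> L" | "k + 2 = L" by linarith
  then show ?thesis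
    by cases (use ladder in \<open>auto simp: step_iff fork_def\<close>)
qed (use L in \<open>auto simp: step_iff fork_def Collect_disj_eq\<close>)

lemma card_left:
  assumes "node k y"
  shows "card {y'. 0 < k \<and> step (k - 1) y' y} =
    (if k = L then 3 else if Suc k = L then 2 else if 0 < k then 1 else 0)"
  using assms
proof (cases rule: node_cases)
  case ladder
  then consider "k = 2" | "3 \<le> k" by linarith
  then show ?thesis
  proof cases
    case 2
    then have "{y'. 0 < k \<and> step (k - 1) y' y} = {y}"
      using ladder by (auto simp: step_iff)
    then show ?thesis
      using ladder by simp
  qed (use ladder in \<open>auto simp: step_iff fork_def\<close>)
qed (use L in \<open>auto simp: step_iff fork_def Collect_disj_eq\<close>)

lemma card_rung:
  assumes "node k y"
  shows "card {y'. rung k y y'} = (if 2 \<le> k \<and> k + 2 \<le> L then 1 else 0)"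
  using assms by (cases rule: node_cases) (use L in \<open>auto simp: rung_def\<close>)

text \<open>
  The numbers of neighbours to the left, to the right and in the same column depend on the
  column only, and their sum is always 3.\<close>
lemma card_neighbours:
  assumes "node k y"
  shows "card {(k', y'). adj k y k' y'} = 3"
proof -
  let ?R = "{y'. step k y y'}" and ?L = "{y'. 0 < k \<and> step (k - 1) y' y}" and ?V = "{y'. rung k y y'}"
  have "finite ?R" "finite ?L" "finite ?V"
    by (auto intro!: finite_subset[of _ "{..8}"] dest!: step_node rung_node dest: node_row)
  moreover have "{(k', y'). adj k y k' y'} = Pair (Suc k) ` ?R \<union> (Pair (k - 1) ` ?L \<union> Pair k ` ?V)"
    by (auto simp: adj_def)
  moreover have "Pair (Suc k) ` ?R \<inter> (Pair (k - 1) ` ?L \<union> Pair k ` ?V) = {}" "Pair (k - 1) ` ?L \<inter> Pair k ` ?V = {}"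
    by auto
  ultimately have "card {(k', y'). adj k y k' y'} = card ?R + (card ?L + card ?V)"
    by (simp add: card_Un_disjoint card_image inj_on_def)
  then show ?thesis
    using assms L node_le[OF assms] unfolding card_right[OF assms] card_left[OF assms] card_rung[OF assms]
    by (auto split: if_splits)
qed

lemma out_degree:
  assumes "v \<in> pverts graph"
  shows "out_degree (with_proj graph) v = 3"
proof -
  obtain k y where v: "v = vtx k y" "node k y"
    using assms by (auto simp: graph_def)
  have "out_arcs (with_proj graph) v = (\<lambda>(k', y'). (v, vtx k' y')) ` {(k', y'). adj k y k' y'}"
    by (auto simp: out_arcs_def v) (auto simp: graph_def)
  then show ?thesis
    using card_neighbours[OF v(2)] by (simp add: out_degree_def card_image inj_on_def split_beta prod_eq_iff)
qed

section \<open>Connectedness\<close>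

text \<open>
  The predicate \<open>P\<close> is an invariant of the walk to the right: it will either restrict the walk to the columns
  beyond the left end of a deleted edge or confine it to a single chain.\<close>
lemma right_reach:
  assumes "P k y" "\<And>k y. P k y \<Longrightarrow> k \<le> L \<and> (k = L \<longrightarrow> y = 4)"
    and "\<And>k y. P k y \<Longrightarrow> k < L \<Longrightarrow> \<exists>y'. (vtx k y, vtx (Suc k) y') \<in> A \<and> P (Suc k) y'"
  shows "(vtx k y, vtx L 4) \<in> A\<^sup>*"
  using assms(1)
proof (induction "L - k" arbitrary: k y)
  case 0
  then show ?case using assms(2)[of k y] by auto
next
  case (Suc n)
  have "k < L"
    using Suc.hyps(2) by linarith
  then obtain y' where "(vtx k y, vtx (Suc k) y') \<in> A" "P (Suc k) y'"
    using assms(3)[of k y] Suc.prems by auto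
  then show ?case
    using Suc.hyps(1)[of "Suc k" y'] Suc.hyps(2) by (auto intro: converse_rtrancl_into_rtrancl)
qed

lemma left_reach:
  assumes "P k y" "\<And>y. P 0 y \<Longrightarrow> y = 4"
    and "\<And>k y. P (Suc k) y \<Longrightarrow> \<exists>y'. (vtx (Suc k) y, vtx k y') \<in> A \<and> P k y'"
  shows "(vtx k y, vtx 0 4) \<in> A\<^sup>*"
  using assms(1)
proof (induction k arbitrary: y)
  case 0
  then show ?case using assms(2)[of y] by auto
next
  case (Suc k)
  then obtain y' where "(vtx (Suc k) y, vtx k y') \<in> A" "P k y'"
    using assms(3)[of k y] by auto
  then show ?case
    using Suc.IH[of y'] by (auto intro: converse_rtrancl_into_rtrancl)
qed

text \<open>
  The second conjunct serves to walk along one chain: outside the first gap and the last one, a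
  step to the right does not leave the chain.\<close>
lemma right_neighbour_ex:
  assumes "node k y" "k < L"
  shows "\<exists>y'. step k y y' \<and> (0 < k \<longrightarrow> Suc k = L \<or> y' div 3 = y div 3)"
  using assms(1)
proof (cases rule: node_cases)
  case first
  then show ?thesis
    by (intro exI[of _ 2]) (simp add: step_iff)
next
  case second
  then show ?thesis
    using L by (intro exI[of _ "3 * (y div 3)"]) (auto simp: step_iff fork_def)
next
  case ladder
  then consider "k + 3 \<le> L" | "k + 2 = L" by linarith
  then show ?thesis
  proof cases
    case 1
    then show ?thesis
      using ladder by (intro exI[of _ y]) (simp add: step_iff)
  next
    case 2
    then show ?thesis
      using ladder by (intro exI[of _ "2 * Suc (y div 3)"]) (auto simp: step_iff fork_def)
  qed
next
  case penultimate
  then show ?thesis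
    by (intro exI[of _ 4]) (simp add: step_iff)
qed (use assms in simp)

lemma left_neighbour_ex:
  assumes "node (Suc k) y"
  shows "\<exists>y'. step k y' y \<and> (Suc k < L \<longrightarrow> k = 0 \<or> y' div 3 = y div 3)"
  using assms(1)
proof (cases rule: node_cases)
  case second
  then show ?thesis
    by (intro exI[of _ 4]) (simp add: step_iff)
next
  case ladder
  then consider "k = 1" | "2 \<le> k" by linarith
  then show ?thesis
  proof cases
    case 1
    then show ?thesis
      using ladder by (intro exI[of _ "2 * Suc (y div 3)"]) (auto simp: step_iff fork_def)
  next
    case 2
    then show ?thesis
      using ladder by (intro exI[of _ y]) (simp add: step_iff)
  qed
next
  case penultimate
  then have "k + 2 = L" by simp
  then show ?thesis
    using penultimate by (intro exI[of _ "3 * (y div 3)"]) (auto simp: step_iff fork_def)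
next
  case last
  then show ?thesis
    by (intro exI[of _ 2]) (simp add: step_iff)
qed simp

lemma adj_cases [consumes 1, case_names left_right right_left vertical]:
  assumes "adj k y k' y'"
  obtains "k' = Suc k" "step k y y'" | "k = Suc k'" "step k' y' y" | "k' = k" "rung k y y'"
  using assms by (auto simp: adj_def)

text \<open>
  An edge touches only one of the three chains.\<close>
lemma chain_avoiding:
  assumes "adj k0 y0 k1 y1" "k0 \<le> k1"
  obtains c where "c \<le> 2" "0 < k0 \<Longrightarrow> y0 div 3 \<noteq> c" "k1 < L \<Longrightarrow> y1 div 3 \<noteq> c"
proof -
  define c0 where "c0 = (if k0 = 0 then y1 div 3 else y0 div 3)"
  have c0: "(0 < k0 \<longrightarrow> y0 div 3 = c0) \<and> (k1 < L \<longrightarrow> y1 div 3 = c0)"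
    using assms(1)
  proof (cases rule: adj_cases)
    case left_right
    from left_right(2) show ?thesis
      by (cases rule: step_cases) (use L left_right(1) in \<open>auto simp: c0_def fork_def\<close>)
  next
    case vertical
    then show ?thesis
      by (auto simp: c0_def rung_def)
  qed (use assms in simp)
  show thesis
    using that[of "if c0 = 0 then 1 else 0"] c0 by (auto split: if_splits)
qed

lemma node_end: "node k y \<Longrightarrow> k \<le> L \<and> (k = L \<longrightarrow> y = 4)"
  and node_start: "node 0 y \<Longrightarrow> y = 4"
  using L by (auto simp: node_def)

text \<open>
  The deleted edge is oriented from left to right. Walks to the right from columns beyond \<open>k0\<close> and
  walks to the left from columns up to \<open>k0\<close> do not meet it, as a non-vertical edge has its left end
  in column \<open>k0\<close> and its right end beyond, and these walks use no vertical edges. So every vertex reaches one of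
  the terminals, and a chain without the edge links the terminals.\<close>
lemma connected_del_edge:
  assumes "adj k0 y0 k1 y1" "k0 \<le> k1"
  shows "Digraph_Component.connected (with_proj (del_edge graph (vtx k0 y0) (vtx k1 y1)))"
proof -
  let ?H = "del_edge graph (vtx k0 y0) (vtx k1 y1)"
  let ?A = "parcs ?H"
  let ?a = "vtx 0 4" and ?b = "vtx L 4"
  have A: "(vtx k y, vtx k' y') \<in> ?A \<longleftrightarrow> adj k y k' y' \<and>
     (k, y, k', y') \<noteq> (k0, y0, k1, y1) \<and> (k, y, k', y') \<noteq> (k1, y1, k0, y0)" for k y k' y'
    by (auto simp: del_edge_def)
  have symA: "sym ?A"
    using sym_parcs by (auto simp: del_edge_def sym_def)
  have right: "(vtx k y, ?b) \<in> ?A\<^sup>*" if "node k y" "k0 < k" for k y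
  proof (rule right_reach[where P = "\<lambda>k y. node k y \<and> k0 < k"])
    show "\<exists>y'. (vtx k y, vtx (Suc k) y') \<in> ?A \<and> node (Suc k) y' \<and> k0 < Suc k"
      if *: "node k y \<and> k0 < k" "k < L" for k y
    proof -
      obtain y' where "step k y y'"
        using right_neighbour_ex * by blast
      then show ?thesis
        using * step_node[of k y y'] assms(2) unfolding A by (intro exI[of _ y']) (auto simp: adj_def)
    qed
  qed (use that node_end in blast)+
  have left: "(vtx k y, ?a) \<in> ?A\<^sup>*" if "node k y" "k \<le> k0" for k y
  proof (rule left_reach[where P = "\<lambda>k y. node k y \<and> k \<le> k0"])
    show "\<exists>y'. (vtx (Suc k) y, vtx k y') \<in> ?A \<and> node k y' \<and> k \<le> k0"
      if *: "node (Suc k) y \<and> Suc k \<le> k0" for k y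
    proof -
      obtain y' where "step k y' y"
        using left_neighbour_ex * by blast
      then show ?thesis
        using * step_node[of k y' y] assms(2) unfolding A by (intro exI[of _ y']) (auto simp: adj_def)
    qed
  qed (use that node_start in blast)+
  have ba: "(?b, ?a) \<in> ?A\<^sup>*"
  proof -
    obtain c where c: "c \<le> 2" "0 < k0 \<Longrightarrow> y0 div 3 \<noteq> c" "k1 < L \<Longrightarrow> y1 div 3 \<noteq> c"
      using chain_avoiding[OF assms] by blast
    \<comment> \<open>the row of the left end of chain \<open>c\<close>\<close>
    let ?m = "2 * Suc c"
    have "c = 0 \<or> c = 1 \<or> c = 2"
      using c(1) by linarith
    then have m: "node 1 ?m" "?m div 3 = c" "0 < (1::nat)"
      by (auto simp: node_def)
    have "(vtx 1 ?m, ?b) \<in> ?A\<^sup>*"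
    proof (rule right_reach[where P = "\<lambda>k y. node k y \<and> 0 < k \<and> (k = L \<or> y div 3 = c)"])
      show "\<exists>y'. (vtx k y, vtx (Suc k) y') \<in> ?A \<and> node (Suc k) y' \<and> 0 < Suc k \<and> (Suc k = L \<or> y' div 3 = c)"
        if *: "node k y \<and> 0 < k \<and> (k = L \<or> y div 3 = c)" "k < L" for k y
      proof -
        obtain y' where "step k y y'" "Suc k = L \<or> y' div 3 = y div 3"
          using right_neighbour_ex[of k y] * by blast
        then show ?thesis
          using * step_node[of k y y'] assms(2) c unfolding A
          by (intro exI[of _ y']) (auto simp: adj_def)
      qed
    qed (use m node_end in blast)+
    moreover have "(vtx 1 ?m, ?a) \<in> ?A\<^sup>*"
    proof (rule left_reach[where P = "\<lambda>k y. k < L \<and> node k y \<and> (k = 0 \<or> y div 3 = c)"])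
      show "\<exists>y'. (vtx (Suc k) y, vtx k y') \<in> ?A \<and> k < L \<and> node k y' \<and> (k = 0 \<or> y' div 3 = c)"
        if *: "Suc k < L \<and> node (Suc k) y \<and> (Suc k = 0 \<or> y div 3 = c)" for k y
      proof -
        obtain y' where "step k y' y" "k = 0 \<or> y' div 3 = y div 3"
          using left_neighbour_ex[of k y] * by blast
        then show ?thesis
          using * step_node[of k y' y] assms(2) c unfolding A
          by (intro exI[of _ y']) (auto simp: adj_def)
      qed
    qed (use m node_start L in auto)
    ultimately show ?thesis
      by (meson rtrancl_trans sym_rtrancl symA symD)
  qed
  show ?thesis
  proof (rule connected_if_all_reach[of ?a])
    show "?a \<in> pverts ?H"
      by (simp add: del_edge_def node_def)
    show "?A \<subseteq> pverts ?H \<times> pverts ?H"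
      using parcs_subset by (auto simp: del_edge_def)
    show "(v, ?a) \<in> ?A\<^sup>*" if v_in: "v \<in> pverts ?H" for v
    proof -
      obtain k y where v: "v = vtx k y" "node k y"
        using v_in by (auto simp: del_edge_def graph_def)
      then show ?thesis
        using left[of k y] right[of k y] ba by (cases "k \<le> k0") (auto intro: rtrancl_trans)
    qed
  qed (rule symA)
qed

lemma no_isthmus: "\<not> isthmus graph u v"
proof
  assume "isthmus graph u v"
  then obtain k y k' y' where e: "u = vtx k y" "v = vtx k' y'" "adj k y k' y'"
    and nc: "\<not> Digraph_Component.connected (with_proj (del_edge graph u v))"
    by (auto simp: isthmus_def graph_def)
  have "del_edge graph u v = del_edge graph v u"
    by (simp add: del_edge_def insert_commute)
  then show False
    using nc connected_del_edge[of k y k' y'] connected_del_edge[of k' y' k y] adj_sym[OF e(3)] e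
    by (metis nat_le_linear)
qed

lemma connected_graph: "Digraph_Component.connected (with_proj graph)"
proof -
  let ?H = "del_edge graph (vtx 0 4) (vtx 1 2)"
  have "Digraph_Component.connected (with_proj ?H)"
    by (rule connected_del_edge) (auto simp: adj_def step_def)
  moreover have "wf_digraph (with_proj graph)" "wf_digraph (with_proj ?H)"
    using parcs_subset by (auto simp: wf_digraph_def del_edge_def)
  then have "spanning (with_proj ?H) (with_proj graph)"
    by (auto simp: spanning_def subgraph_def compatible_def del_edge_def)
  ultimately show ?thesis
    using wf_digraph.connected_spanning_imp_connected \<open>wf_digraph (with_proj graph)\<close> by blast
qed

section \<open>No Hamiltonian cycle\<close>

lemma no_hamiltonian_cycle: "\<not> hamiltonian_cycle graph p"
proof (rule no_hamiltonian_cycle_many_parts)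
  let ?S = "\<lambda>c. {vtx k y | k y. 0 < k \<and> k < L \<and> y div 3 = c}"
  let ?T = "{vtx 0 4, vtx L 4}"
  show "card ?T < card {..<3::nat}"
    using L by simp
  show "?T \<subseteq> pverts graph"
    by (simp add: node_def)
  show "?S c \<inter> pverts graph \<noteq> {}" if "c \<in> {..<3}" for c
  proof -
    have "c = 0 \<or> c = 1 \<or> c = 2"
      using that by auto
    then have "vtx 1 (2 * Suc c) \<in> ?S c \<inter> pverts graph"
      using L by (auto simp: node_def)
    then show ?thesis by blast
  qed
  show "v \<in> ?T" if "c \<in> {..<3}" and uv: "(u, v) \<in> parcs graph" "u \<in> ?S c" "v \<notin> ?S c" for c u v
  proof -
    obtain k y k' y' where e: "u = vtx k y" "v = vtx k' y'" "adj k y k' y'"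
      using uv by (auto simp: graph_def)
    have "k' = 0 \<or> k' = L \<or> y' div 3 = y div 3"
      using e(3)
    proof (cases rule: adj_cases)
      case left_right
      from left_right(2) show ?thesis
        by (cases rule: step_cases) (use e uv(2) left_right(1) in \<open>auto simp: fork_def\<close>)
    next
      case right_left
      from right_left(2) show ?thesis
        by (cases rule: step_cases) (use e uv(2) right_left(1) in \<open>auto simp: fork_def\<close>)
    qed (auto simp: rung_def)
    moreover have "node k' y'"
      using e adj_node by blast
    ultimately show ?thesis
      using uv(2,3) e L node_le[of k' y'] by (auto simp: node_def)
  qed
qed (auto simp: disjoint_family_on_def)

section \<open>The straight-line drawing\<close>

text \<open>
  The shift by 4 puts the terminals on the real axis, which becomes an axis of symmetry.\<close>
definition pos :: "nat \<Rightarrow> complex" where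
  "pos v = (case prod_decode v of (k, y) \<Rightarrow> Complex (real k) (real y - 4))"

definition curve :: "nat \<times> nat \<Rightarrow> real \<Rightarrow> complex" where
  "curve e = linepath (pos (fst e)) (pos (snd e))"

text \<open>
  A slant is the segment of an edge over the gap to the right of column \<open>k\<close>, an upright that of a
  rung. As subsets of the plane in coordinates they are easier to intersect than segments.\<close>
definition slant :: "nat \<Rightarrow> nat \<Rightarrow> nat \<Rightarrow> complex set" where
  "slant k y y' = {z. real k \<le> Re z \<and> Re z \<le> real k + 1 \<and>
     Im z = real y - 4 + (Re z - real k) * (real y' - real y)}"

definition upright :: "nat \<Rightarrow> nat \<Rightarrow> nat \<Rightarrow> complex set" where
  "upright k y y' = {z. Re z = real k \<and> Im z \<in> closed_segment (real y - 4) (real y' - 4)}"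

lemma pos_vtx [simp]: "pos (vtx k y) = Complex (real k) (real y - 4)"
  by (simp add: pos_def vtx_def)

lemma inj_pos: "inj pos"
  by (rule inj_onI) (metis (no_types, lifting) add_diff_cancel_right' case_prod_beta complex.inject
      diff_add_cancel of_nat_eq_iff pos_def prod.expand prod_decode_inverse)

lemma path_image_curve_commute: "path_image (curve (v, u)) = path_image (curve (u, v))"
  by (simp add: curve_def closed_segment_commute)

lemma path_image_step: "path_image (curve (vtx k y, vtx (Suc k) y')) = slant k y y'"
  using closed_segment_unit_width[of "real k" "real y - 4" "real y' - 4"]
  by (simp add: curve_def slant_def add.commute)

lemma path_image_rung: "path_image (curve (vtx k y, vtx k y')) = upright k y y'"
  by (simp add: curve_def upright_def closed_segment_same_Re)

lemma edge_cases:
  assumes "e \<in> parcs graph"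
  obtains k y y' where "e = (vtx k y, vtx (Suc k) y') \<or> e = (vtx (Suc k) y', vtx k y)"
      "step k y y'" "path_image (curve e) = slant k y y'"
  | k y y' where "e = (vtx k y, vtx k y')" "rung k y y'" "path_image (curve e) = upright k y y'"
proof -
  obtain k y k' y' where e: "e = (vtx k y, vtx k' y')" "adj k y k' y'"
    using assms by (auto simp: graph_def)
  from e(2) show thesis
  proof (cases rule: adj_cases)
    case left_right
    then show ?thesis using that(1)[of k y y'] e(1) by (simp add: path_image_step)
  next
    case right_left
    then show ?thesis
      using that(1)[of k' y' y] e(1) path_image_curve_commute[of "vtx k y" "vtx k' y'"]
      by (simp add: path_image_step)
  next
    case vertical
    then show ?thesis using that(2)[of k y y'] e(1) by (simp add: path_image_rung)
  qed
qed

lemma vertex_in_pos: "node k y \<Longrightarrow> Re z = real k \<Longrightarrow> Im z = real y - 4 \<Longrightarrow> z \<in> pos ` pverts graph"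
  by (rule image_eqI[of _ _ "vtx k y"]) (auto simp: complex_eq_iff)

lemma slant_at_column:
  assumes "z \<in> slant k y y'" "Re z = real j"
  shows "j = k \<and> Im z = real y - 4 \<or> j = Suc k \<and> Im z = real y' - 4"
proof -
  have "j = k \<or> j = Suc k"
    using assms by (auto simp: slant_def)
  then show ?thesis
    using assms by (auto simp: slant_def)
qed

lemma slant_at_column_vertex:
  assumes "step k y y'" "z \<in> slant k y y'" "Re z = real j"
  shows "z \<in> pos ` pverts graph"
  using slant_at_column[OF assms(2,3)] step_node[OF assms(1)] assms(3) by (auto intro: vertex_in_pos)

text \<open>
  The combinatorial core of planarity: edges over the same gap do not change their vertical order.\<close>
lemma step_mono:
  assumes "step k y1 y1'" "step k y2 y2'" "y1 < y2"
  shows "y1' \<le> y2'"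
  using assms(1)
proof (cases rule: step_cases)
  case first
  then show ?thesis using assms L by (simp add: step_iff)
next
  case fork
  then show ?thesis using assms L by (auto simp: step_iff fork_def)
next
  case rail
  then show ?thesis using assms L by (auto simp: step_iff)
next
  case join
  then show ?thesis using assms by (simp add: step_iff) (auto simp: fork_def)
next
  case last
  then show ?thesis using assms by (simp add: step_iff)
qed

text \<open>
  The vertical distance of two affine functions that is positive at the left end of the gap and
  nonnegative at the right end can vanish only at the right end.\<close>
lemma ordered_slants_meet_right:
  assumes "step k y1 y1'" "step k y2 y2'" "y1 < y2"
    and z: "z \<in> slant k y1 y1'" "z \<in> slant k y2 y2'"
  shows "Re z = real (Suc k)"
proof -
  define t where "t = Re z - real k"
  have "t \<le> 1" "0 \<le> t" and "real y1 + t * (real y1' - real y1) = real y2 + t * (real y2' - real y2)"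
    using z by (auto simp: slant_def t_def)
  then have "(1 - t) * (real y2 - real y1) + t * (real y2' - real y1') = 0"
    by (simp add: algebra_simps)
  moreover have "t * (real y2' - real y1') \<ge> 0"
    using step_mono[OF assms(1-3)] \<open>0 \<le> t\<close> by simp
  ultimately have "(1 - t) * (real y2 - real y1) \<le> 0"
    by linarith
  then have "1 \<le> t"
    using \<open>y1 < y2\<close> by (simp add: mult_le_0_iff)
  then show ?thesis
    using \<open>t \<le> 1\<close> by (simp add: t_def)
qed

text \<open>
  It suffices that the common point lies in a column, because a slant meets the columns only at its ends.\<close>
lemma slants_meet_at_vertex:
  assumes "step k1 y1 y1'" "step k2 y2 y2'" "(k1, y1, y1') \<noteq> (k2, y2, y2')"
    and z: "z \<in> slant k1 y1 y1'" "z \<in> slant k2 y2 y2'"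
  shows "z \<in> pos ` pverts graph"
proof -
  consider "k1 < k2" | "k2 < k1" | "k1 = k2" "y1 = y2" | "k1 = k2" "y1 < y2" | "k1 = k2" "y2 < y1"
    by linarith
  then have "\<exists>j. Re z = real j"
  proof cases
    case 1
    then have "Re z = real k2"
      using z by (auto simp: slant_def)
    then show ?thesis ..
  next
    case 2
    then have "Re z = real k1"
      using z by (auto simp: slant_def)
    then show ?thesis ..
  next
    case 3
    then have "(Re z - real k1) * (real y1' - real y2') = 0"
      using z by (simp add: slant_def algebra_simps)
    then have "Re z = real k1"
      using 3 assms(3) by auto
    then show ?thesis ..
  next
    case 4
    then have "Re z = real (Suc k1)"
      using ordered_slants_meet_right[of k1 y1 y1' y2 y2' z] assms by auto
    then show ?thesis ..
  next
    case 5
    then have "Re z = real (Suc k1)"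
      using ordered_slants_meet_right[of k1 y2 y2' y1 y1' z] assms by auto
    then show ?thesis ..
  qed
  then show ?thesis
    using slant_at_column_vertex[OF assms(1) z(1)] by blast
qed

text \<open>
  Rungs in the same column occupy the disjoint ranges of rows \<open>0..2\<close>, \<open>3..5\<close> and \<open>6..8\<close>.\<close>
lemma uprights_meet:
  assumes "rung k1 y1 y1'" "rung k2 y2 y2'" "z \<in> upright k1 y1 y1'" "z \<in> upright k2 y2 y2'"
  shows "k1 = k2 \<and> (y1 = y2 \<and> y1' = y2' \<or> y1 = y2' \<and> y1' = y2)"
proof -
  have "k1 = k2"
    using assms(3,4) by (auto simp: upright_def)
  moreover have "Im z \<in> closed_segment (real y1 - 4) (real y1' - 4)" "Im z \<in> closed_segment (real y2 - 4) (real y2' - 4)"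
    using assms(3,4) by (auto simp: upright_def)
  ultimately show ?thesis
    using assms(1,2) by (auto simp: rung_def closed_segment_eq_real_ivl)
qed

lemma node_on_upright:
  assumes "rung k y y'" "node k w" "real w - 4 \<in> closed_segment (real y - 4) (real y' - 4)"
  shows "w = y \<or> w = y'"
  using assms(2) 
proof (cases rule: node_cases)
  case ladder
  then show ?thesis
    using assms(1,3) by (auto simp: rung_def closed_segment_eq_real_ivl)
qed (use L assms(1) in \<open>auto simp: rung_def\<close>)

lemma vertices_on_edge:
  assumes "(u, v) \<in> parcs graph"
  shows "path_image (curve (u, v)) \<inter> pos ` pverts graph = {pos u, pos v}"
proof
  have "u \<in> pverts graph" "v \<in> pverts graph"
    using parcs_subset assms by auto
  then show "{pos u, pos v} \<subseteq> path_image (curve (u, v)) \<inter> pos ` pverts graph"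
    by (auto simp: curve_def)
  show "path_image (curve (u, v)) \<inter> pos ` pverts graph \<subseteq> {pos u, pos v}"
  proof
    fix z assume z: "z \<in> path_image (curve (u, v)) \<inter> pos ` pverts graph"
    then obtain j w where jw: "node j w" "Re z = real j" "Im z = real w - 4"
      by (auto simp: graph_def)
    from assms show "z \<in> {pos u, pos v}"
    proof (cases rule: edge_cases)
      case (1 k y y')
      then have "z \<in> slant k y y'" using z by auto
      from slant_at_column[OF this jw(2)] show ?thesis
        using 1(1) jw by (auto simp: complex_eq_iff)
    next
      case (2 k y y')
      then have "j = k" "real w - 4 \<in> closed_segment (real y - 4) (real y' - 4)"
        using z jw by (auto simp: upright_def)
      then show ?thesis
        using node_on_upright[OF 2(2)] 2(1) jw by (auto simp: complex_eq_iff)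
    qed
  qed
qed

lemma edges_meet_at_vertices:
  assumes "e \<in> parcs graph" "f \<in> parcs graph" "f \<noteq> e" "f \<noteq> prod.swap e"
    and z: "z \<in> path_image (curve e)" "z \<in> path_image (curve f)"
  shows "z \<in> pos ` pverts graph"
  using assms(1)
proof (cases rule: edge_cases)
  case e: (1 k1 y1 y1')
  from assms(2) show ?thesis
  proof (cases rule: edge_cases)
    case f: (1 k2 y2 y2')
    have "(k1, y1, y1') \<noteq> (k2, y2, y2')"
      using assms(3,4) e(1) f(1) by auto
    then show ?thesis
      using slants_meet_at_vertex[OF e(2) f(2)] z e(3) f(3) by auto
  next
    case f: (2 k2 y2 y2')
    then show ?thesis
      using slant_at_column_vertex[OF e(2)] z e(3) by (auto simp: upright_def)
  qed
next
  case e: (2 k1 y1 y1')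
  from assms(2) show ?thesis
  proof (cases rule: edge_cases)
    case f: (1 k2 y2 y2')
    then show ?thesis
      using slant_at_column_vertex[OF f(2)] z e(3) by (auto simp: upright_def)
  next
    case f: (2 k2 y2 y2')
    then show ?thesis
      using uprights_meet[OF e(2) f(2)] z e(1,3) assms(3,4) by auto
  qed
qed

lemma plane_embedding: "plane_embedding graph pos curve"
proof -
  have ends: "pathstart (curve (u, v)) = pos u" "pathfinish (curve (u, v)) = pos v" for u v
    by (auto simp: curve_def)
  have arc: "arc (curve (u, v))" if uv: "(u, v) \<in> parcs graph" for u v
  proof -
    have "u \<noteq> v"
      using uv pair_graph pair_loopfree_digraph.no_loops' by (auto simp: graph_def adj_def rung_def)
    then show ?thesis
      using injD[OF inj_pos] by (auto simp: curve_def intro: arc_linepath)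
  qed
  show ?thesis
    unfolding plane_embedding_def
  proof (intro conjI)
    show "inj_on pos (pverts graph)"
      using inj_pos by (rule inj_on_subset) simp
  qed (use ends arc vertices_on_edge path_image_curve_commute edges_meet_at_vertices in blast)+
qed

lemma planar_map: "planar_map graph"
  using pair_graph connected_graph plane_embedding out_degree no_isthmus
  by (auto simp: planar_map_def planar_def connected_simple_graph_def)

section \<open>Faces\<close>

definition drawing :: "complex set" where
  "drawing = pos ` pverts graph \<union> (\<Union>e\<in>parcs graph. path_image (curve e))"

lemma faces_eq: "faces graph pos curve = components (- drawing)"
  by (simp add: faces_def drawing_def)

text \<open>
  No vertex is isolated, so the points drawn for vertices are covered by the edges.\<close>
lemma drawing_eq: "drawing = (\<Union>e\<in>parcs graph. path_image (curve e))"
proof -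
  have "pos v \<in> (\<Union>e\<in>parcs graph. path_image (curve e))" if v: "v \<in> pverts graph" for v
  proof -
    obtain w where "(v, w) \<in> parcs graph"
    proof -
      obtain k y where ky: "v = vtx k y" "node k y"
        using v by (auto simp: graph_def)
      show thesis
      proof (cases "k < L")
        case True
        then show thesis
          using right_neighbour_ex[OF ky(2)] that ky(1) by (metis adj_def vtx_in_parcs)
      next
        case False
        then obtain j where "k = Suc j"
          using L by (cases k) auto
        then show thesis
          using left_neighbour_ex[of j y] that ky by (metis adj_def vtx_in_parcs)
      qed
    qed
    moreover have "pos v \<in> path_image (curve (v, w))"
      by (simp add: curve_def)
    ultimately show ?thesis by blast
  qed
  then show ?thesis
    by (auto simp: drawing_def)
qed

lemma slant_subset_drawing: "step k y y' \<Longrightarrow> slant k y y' \<subseteq> drawing"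
  unfolding drawing_eq path_image_step[symmetric] by (rule UN_upper) (simp add: adj_def)

lemma upright_subset_drawing: "rung k y y' \<Longrightarrow> upright k y y' \<subseteq> drawing"
  unfolding drawing_eq path_image_rung[symmetric] by (rule UN_upper) (simp add: adj_def)

lemma drawing_cases:
  assumes "z \<in> drawing"
  obtains k y y' where "step k y y'" "z \<in> slant k y y'" | k y y' where "rung k y y'" "z \<in> upright k y y'"
  using assms unfolding drawing_eq by (auto elim!: edge_cases)

lemma closed_drawing: "closed drawing"
  unfolding drawing_eq using finite_parcs
  by (intro closed_UN) (auto simp: curve_def)

text \<open>
  The line through the segment from \<open>pos u\<close> to \<open>pos v\<close> has the normal vector \<open>\<i> * (pos v - pos u)\<close>.\<close>
lemma finite_faces: "finite (faces graph pos curve)"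
  unfolding faces_eq
proof (rule finite_components_complement)
  let ?n = "\<lambda>(u, v). \<i> * (pos v - pos u)"
  let ?A = "(\<lambda>e. (?n e, ?n e \<bullet> pos (fst e))) ` parcs graph"
  show "finite ?A"
    using finite_parcs by simp
  show "a \<noteq> 0" if ab: "(a, b) \<in> ?A" for a b
  proof -
    obtain u v where uv: "(u, v) \<in> parcs graph" "a = \<i> * (pos v - pos u)"
      using ab by auto
    then have "u \<noteq> v"
      by (auto simp: graph_def adj_def rung_def)
    then show ?thesis
      using uv(2) injD[OF inj_pos, of u v] by auto
  qed
  show "drawing \<subseteq> (\<Union>(a, b)\<in>?A. {z. a \<bullet> z = b})"
    unfolding drawing_eq using closed_segment_subset_hyperplane
    by (fastforce simp: curve_def)
qed (rule closed_drawing)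

text \<open>
  The inside of a cell of the middle ladder: its rails, rows 3 and 5, are drawn at imaginary parts
  \<open>-1\<close> and \<open>1\<close>.\<close>
definition rect :: "nat \<Rightarrow> complex set" where
  "rect k = box (Complex (real k) (-1)) (Complex (real k + 1) 1)"

lemma in_rect: "z \<in> rect k \<longleftrightarrow> real k < Re z \<and> Re z < real k + 1 \<and> -1 < Im z \<and> Im z < 1"
  by (auto simp: rect_def in_box_complex_iff)

lemma rect_disjoint_drawing:
  assumes "2 \<le> k" "k + 3 \<le> L"
  shows "rect k \<inter> drawing = {}"
proof -
  have False if z: "z \<in> rect k" "z \<in> drawing" for z
    using z(2)
  proof (cases rule: drawing_cases)
    case (1 j y y')
    then have "j = k"
      using z(1) by (auto simp: slant_def in_rect)
    then show False
      using 1 z(1) assms by (auto simp: slant_def in_rect step_iff)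
  next
    case (2 j y y')
    then show False
      using z(1) by (auto simp: upright_def in_rect)
  qed
  then show ?thesis by blast
qed

lemma rect_in_faces:
  assumes k: "2 \<le> k" "k + 3 \<le> L"
  shows "rect k \<in> faces graph pos curve"
  unfolding faces_eq
proof (rule in_components_complementI)
  have "Complex (real k + 1/2) 0 \<in> rect k"
    by (simp add: in_rect)
  then show ne: "rect k \<noteq> {}" by blast
  show "topological_space_class.connected (rect k)"
    by (simp add: rect_def convex_connected)
  show "frontier (rect k) \<subseteq> drawing"
  proof
    fix z assume "z \<in> frontier (rect k)"
    then have "real k \<le> Re z" "Re z \<le> real k + 1" "-1 \<le> Im z" "Im z \<le> 1"
      and "Re z = real k \<or> Re z = real (Suc k) \<or> Im z = -1 \<or> Im z = 1"
      using ne by (auto simp: rect_def frontier_box in_box_complex_iff in_cbox_complex_iff)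
    then have "z \<in> upright k 3 5 \<or> z \<in> upright (Suc k) 3 5 \<or> z \<in> slant k 3 3 \<or> z \<in> slant k 5 5"
      by (auto simp: upright_def slant_def closed_segment_eq_real_ivl)
    moreover have "rung k 3 5" "rung (Suc k) 3 5" "step k 3 3" "step k 5 5"
      using k by (auto simp: rung_def step_iff)
    ultimately show "z \<in> drawing"
      using slant_subset_drawing upright_subset_drawing by blast
  qed
qed (rule rect_disjoint_drawing[OF k])

text \<open>
  Finiteness matters here, as infinite sets have cardinality 0.\<close>
lemma card_faces: "L - 4 \<le> card (faces graph pos curve)"
proof -
  have "inj rect"
  proof (rule injI)
    fix j k assume "rect j = rect k"
    moreover have "Complex (real j + 1/2) 0 \<in> rect j"
      by (simp add: in_rect)
    ultimately have "Complex (real j + 1/2) 0 \<in> rect k"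
      by simp
    then show "j = k"
      by (simp add: in_rect)
  qed
  moreover have "rect ` {2..<L - 2} \<subseteq> faces graph pos curve"
    using rect_in_faces by auto
  ultimately have "card {2..<L - 2} \<le> card (faces graph pos curve)"
    using finite_faces by (intro card_inj_on_le) (auto intro: inj_on_subset)
  then show ?thesis by simp
qed

lemma card_edges: "L - 3 \<le> card (edges graph)"
proof -
  have "inj_on (\<lambda>k. {vtx k 3, vtx k 5}) {2..<L - 1}"
    by (auto simp: inj_on_def doubleton_eq_iff)
  moreover have "(\<lambda>k. {vtx k 3, vtx k 5}) ` {2..<L - 1} \<subseteq> edges graph"
  proof
    fix s assume "s \<in> (\<lambda>k. {vtx k 3, vtx k 5}) ` {2..<L - 1}"
    then obtain k where k: "s = {vtx k 3, vtx k 5}" "2 \<le> k" "k < L - 1" by auto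
    then have "(vtx k 3, vtx k 5) \<in> parcs graph"
      by (simp add: adj_def rung_def)
    then show "s \<in> edges graph"
      unfolding edges_def k(1) by force
  qed
  ultimately have "card {2..<L - 1} \<le> card (edges graph)"
    using finite_parcs by (intro card_inj_on_le) (auto simp: edges_def)
  then show ?thesis by simp
qed

lemma card_pverts: "L - 3 \<le> card (pverts graph)"
proof -
  have "inj_on (\<lambda>k. vtx k 3) {2..<L - 1}"
    by (auto simp: inj_on_def)
  moreover have "(\<lambda>k. vtx k 3) ` {2..<L - 1} \<subseteq> pverts graph"
    by (auto simp: node_def)
  ultimately have "card {2..<L - 1} \<le> card (pverts graph)"
    using finite_pverts by (intro card_inj_on_le)
  then show ?thesis by simp
qed

text \<open>
  The outline of the drawing consists of the graphs of \<open>height\<close> and its negative: slope 2 over the first two gaps,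
  then constant, then slope \<open>-2\<close> over the last two gaps. This function is concave, so the
  region enclosed by the outline is convex.\<close>
definition height :: "real \<Rightarrow> real" where
  "height x = min 4 (min (2 * x) (2 * (real L - x)))"

definition silhouette :: "complex set" where
  "silhouette = {z. \<bar>Im z\<bar> \<le> height (Re z)}"

lemma convex_silhouette: "convex silhouette"
proof -
  have half: "convex {z. a * Re z + b * Im z \<le> c}" for a b c
    using convex_halfspace_le[of "Complex a b" c] by (simp add: inner_complex_def)
  have "silhouette = {z. 0 * Re z + 1 * Im z \<le> 4} \<inter> {z. 0 * Re z + (-1) * Im z \<le> 4} \<inter>
    {z. (-2) * Re z + 1 * Im z \<le> 0} \<inter> {z. (-2) * Re z + (-1) * Im z \<le> 0} \<inter>
    {z. 2 * Re z + 1 * Im z \<le> 2 * real L} \<inter> {z. 2 * Re z + (-1) * Im z \<le> 2 * real L}"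
    by (auto simp: silhouette_def height_def)
  then show ?thesis
    by (simp only:) (intro convex_Int half)
qed

lemma bounded_silhouette: "bounded silhouette"
proof (rule bounded_subset[OF bounded_cbox])
  show "silhouette \<subseteq> cbox (Complex 0 (-4)) (Complex (real L) 4)"
    by (auto simp: silhouette_def height_def in_cbox_complex_iff)
qed

text \<open>
  A point with \<open>\<bar>Im z\<bar> = height (Re z)\<close> leaves the silhouette under an arbitrarily small
  vertical move away from the real axis.\<close>
lemma frontier_silhouette: "frontier silhouette = {z. \<bar>Im z\<bar> = height (Re z)}"
proof -
  have cont: "continuous_on UNIV (\<lambda>z. \<bar>Im z\<bar>)" "continuous_on UNIV (\<lambda>z. height (Re z))"
    unfolding height_def by (intro continuous_intros)+
  have "closed silhouette"
    unfolding silhouette_def using cont by (intro closed_Collect_le) 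
  moreover have "interior silhouette = {z. \<bar>Im z\<bar> < height (Re z)}"
  proof (rule interior_unique)
    show "open {z. \<bar>Im z\<bar> < height (Re z)}"
      using cont by (intro open_Collect_less)
    show "{z. \<bar>Im z\<bar> < height (Re z)} \<subseteq> silhouette"
      by (auto simp: silhouette_def)
    show "T \<subseteq> {z. \<bar>Im z\<bar> < height (Re z)}" if T: "T \<subseteq> silhouette" "open T" for T
    proof
      fix z assume "z \<in> T"
      then obtain e where e: "e > 0" "cball z e \<subseteq> T"
        using T(2) open_contains_cball by blast
      have "Complex (Re z) (Im z + e) \<in> cball z e" "Complex (Re z) (Im z - e) \<in> cball z e"
        using e(1) by (auto simp: dist_complex_def cmod_def)
      then have "Complex (Re z) (Im z + e) \<in> silhouette" "Complex (Re z) (Im z - e) \<in> silhouette"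
        using e(2) T(1) by blast+
      then show "z \<in> {z. \<bar>Im z\<bar> < height (Re z)}"
        using e(1) by (auto simp: silhouette_def)
    qed
  qed
  ultimately show ?thesis
    by (auto simp: frontier_def silhouette_def)
qed

lemma drawing_subset_silhouette: "drawing \<subseteq> silhouette"
proof -
  have "pos v \<in> silhouette" if v: "v \<in> pverts graph" for v
  proof -
    obtain k y where ky: "v = vtx k y" "node k y"
      using v by (auto simp: graph_def)
    from ky(2) have "\<bar>real y - 4\<bar> \<le> height (real k)"
      by (cases rule: node_cases) (use L in \<open>auto simp: height_def\<close>)
    then show ?thesis
      by (simp add: ky(1) silhouette_def)
  qed
  moreover have "fst e \<in> pverts graph" "snd e \<in> pverts graph" if "e \<in> parcs graph" for e
    using that parcs_subset by auto
  ultimately have "path_image (curve e) \<subseteq> silhouette" if "e \<in> parcs graph" for e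
    using that closed_segment_subset[OF _ _ convex_silhouette] by (simp add: curve_def)
  then show ?thesis
    by (auto simp: drawing_eq)
qed

text \<open>
  The values of \<open>height\<close> at the columns. Being at most 4, they can be subtracted from 4 within the naturals;
  the rows \<open>4 - rise k\<close> and \<open>4 + rise k\<close> are the lowest and the highest row in use in column \<open>k\<close>.\<close>
definition rise :: "nat \<Rightarrow> nat" where
  "rise k = min 4 (min (2 * k) (2 * (L - k)))"

lemma rise_cases:
  assumes "k < L"
  obtains "k \<le> 1" "rise k = 2 * k" "rise (Suc k) = 2 * k + 2"
    | "2 \<le> k" "k + 3 \<le> L" "rise k = 4" "rise (Suc k) = 4"
    | "k + 2 = L" "rise k = 4" "rise (Suc k) = 2" | "Suc k = L" "rise k = 2" "rise (Suc k) = 0"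
proof -
  consider "k \<le> 1" | "2 \<le> k" "k + 3 \<le> L" | "k + 2 = L" | "Suc k = L"
    using assms by linarith
  then show thesis
  proof cases
    case 2
    then have "rise k = 4" "rise (Suc k) = 4"
      by (auto simp: rise_def min_def)
    then show thesis
      using that(2) 2 by simp
  qed (use that L in \<open>auto simp: rise_def min_def\<close>)
qed

lemma step_rim:
  assumes "k < L"
  shows "step k (4 - rise k) (4 - rise (Suc k))" "step k (4 + rise k) (4 + rise (Suc k))"
proof -
  from assms have "step k (4 - rise k) (4 - rise (Suc k)) \<and> step k (4 + rise k) (4 + rise (Suc k))"
  proof (cases rule: rise_cases)
    case 1
    then consider "k = 0" | "k = 1" by linarith
    then show ?thesis
      by cases (use 1 in \<open>simp_all add: step_iff fork_def\<close>)
  qed (simp_all add: step_iff fork_def)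
  then show "step k (4 - rise k) (4 - rise (Suc k))" "step k (4 + rise k) (4 + rise (Suc k))"
    by blast+
qed

text \<open>
  The kinks of \<open>height\<close> are at the columns \<open>2\<close> and \<open>L - 2\<close>, so it is affine between consecutive columns.\<close>
lemma height_between:
  assumes "k < L" "real k \<le> x" "x \<le> real k + 1"
  shows "height x = real (rise k) + (x - real k) * (real (rise (Suc k)) - real (rise k))"
  using assms(1)
proof (cases rule: rise_cases)
  case 1
  then have "2 * x \<le> 4" "2 * x \<le> 2 * (real L - x)"
    using assms L by auto
  then show ?thesis
    using 1 by (simp add: height_def algebra_simps)
next
  case 2
  then have "4 \<le> 2 * x" "4 \<le> 2 * (real L - x)"
    using assms L by auto
  then show ?thesis
    using 2 by (simp add: height_def)
next
  case 3
  then have "4 \<le> 2 * x" "2 * (real L - x) \<le> 4" "real L = real k + 2"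
    using assms L by auto
  then show ?thesis
    using 3 by (simp add: height_def algebra_simps)
next
  case 4
  then have "4 \<le> 2 * x" "2 * (real L - x) \<le> 4" "real L = real k + 1"
    using assms L by auto
  then show ?thesis
    using 4 by (simp add: height_def algebra_simps)
qed

lemma slant_rim:
  assumes "k < L"
  shows "slant k (4 - rise k) (4 - rise (Suc k)) =
      {z. real k \<le> Re z \<and> Re z \<le> real k + 1 \<and> Im z = - height (Re z)}"
    and "slant k (4 + rise k) (4 + rise (Suc k)) =
      {z. real k \<le> Re z \<and> Re z \<le> real k + 1 \<and> Im z = height (Re z)}"
proof -
  have "rise k \<le> 4" "rise (Suc k) \<le> 4"
    by (auto simp: rise_def)
  then have "real (4 - rise k) - 4 + (x - real k) * (real (4 - rise (Suc k)) - real (4 - rise k)) = - height x"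
    and "real (4 + rise k) - 4 + (x - real k) * (real (4 + rise (Suc k)) - real (4 + rise k)) = height x"
    if "real k \<le> x" "x \<le> real k + 1" for x
    using height_between[OF assms that] by (simp_all add: of_nat_diff algebra_simps)
  then show "slant k (4 - rise k) (4 - rise (Suc k)) =
      {z. real k \<le> Re z \<and> Re z \<le> real k + 1 \<and> Im z = - height (Re z)}"
    and "slant k (4 + rise k) (4 + rise (Suc k)) =
      {z. real k \<le> Re z \<and> Re z \<le> real k + 1 \<and> Im z = height (Re z)}"
    by (auto simp: slant_def)
qed

text \<open>
  The outline of the drawing, traversed from the left terminal along the bottom to the right
  terminal and back along the top.\<close>
definition rim :: "(nat \<times> nat) list" where
  "rim = map (\<lambda>k. (vtx k (4 - rise k), vtx (Suc k) (4 - rise (Suc k)))) [0..<L] @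
         map (\<lambda>k. (vtx (Suc k) (4 + rise (Suc k)), vtx k (4 + rise k))) (rev [0..<L])"

lemma length_rim: "length rim = 2 * L"
  by (simp add: rim_def)

lemma path_image_rim: "(\<Union>e\<in>set rim. path_image (curve e)) = frontier silhouette"
proof -
  have "(\<Union>e\<in>set rim. path_image (curve e)) =
    (\<Union>k<L. slant k (4 - rise k) (4 - rise (Suc k)) \<union> slant k (4 + rise k) (4 + rise (Suc k)))"
    unfolding rim_def by (auto simp: path_image_step path_image_curve_commute[of "vtx (Suc _) _"])
  also have "\<dots> = {z. \<bar>Im z\<bar> = height (Re z)}"
  proof (intro set_eqI iffI)
    fix z assume "z \<in> (\<Union>k<L. slant k (4 - rise k) (4 - rise (Suc k)) \<union> slant k (4 + rise k) (4 + rise (Suc k)))"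
    then obtain k where k: "k < L" "real k \<le> Re z" "Re z \<le> real k + 1" "\<bar>Im z\<bar> = \<bar>height (Re z)\<bar>"
      using slant_rim by auto
    moreover have "0 \<le> height (Re z)"
      using k by (auto simp: height_def)
    ultimately show "z \<in> {z. \<bar>Im z\<bar> = height (Re z)}"
      by simp
  next
    fix z assume z: "z \<in> {z. \<bar>Im z\<bar> = height (Re z)}"
    then have Re: "0 \<le> Re z" "Re z \<le> real L"
      by (auto simp: height_def)
    obtain k where k: "k < L" "real k \<le> Re z" "Re z \<le> real k + 1"
    proof (cases "Re z = real L")
      case True
      then show thesis using that[of "L - 1"] L by auto
    next
      case False
      show thesis
      proof (rule that[of "nat \<lfloor>Re z\<rfloor>"])
        show "nat \<lfloor>Re z\<rfloor> < L" using False Re by linarith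
      qed (use Re in linarith)+
    qed
    then show "z \<in> (\<Union>k<L. slant k (4 - rise k) (4 - rise (Suc k)) \<union> slant k (4 + rise k) (4 + rise (Suc k)))"
      using z slant_rim[OF k(1)] by (auto simp: abs_if split: if_splits intro!: bexI[of _ k])
  qed
  finally show ?thesis
    by (simp add: frontier_silhouette)
qed

text \<open>
  The complement of a bounded convex set in the plane is connected.\<close>
lemma outer_face: "- silhouette \<in> faces graph pos curve"
  unfolding faces_eq
proof (rule in_components_complementI)
  show "topological_space_class.connected (- silhouette)"
    using bounded_silhouette convex_silhouette by (intro connected_complement_bounded_convex) auto
  have "Complex 0 5 \<in> - silhouette"
    by (simp add: silhouette_def height_def)
  then show "- silhouette \<noteq> {}" by blast
  have "e \<in> parcs graph" if "e \<in> set rim" for e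
    using that step_rim by (auto simp: rim_def adj_def)
  then show "frontier (- silhouette) \<subseteq> drawing"
    by (auto simp: path_image_rim[symmetric] drawing_eq)
qed (use drawing_subset_silhouette in blast)

lemma pcas_right: "pcas (f 0) (map (\<lambda>k. (f k, f (Suc k))) [0..<n]) (f n)"
  by (induction n) (auto simp: pcas_append)

lemma pcas_left: "pcas (f n) (map (\<lambda>k. (f (Suc k), f k)) (rev [0..<n])) (f 0)"
  by (induction n) auto

lemma elementary_cycle_rim: "elementary_cycle graph rim"
proof -
  have ends: "rise 0 = 0" "rise L = 0"
    by (auto simp: rise_def)
  have walk: "pcas (vtx 0 4) rim (vtx 0 4)"
    unfolding rim_def pcas_append
    using pcas_right[of "\<lambda>k. vtx k (4 - rise k)" L] pcas_left[of "\<lambda>k. vtx k (4 + rise k)" L] ends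
    by auto
  have "set rim \<subseteq> parcs graph"
    using step_rim by (auto simp: rim_def adj_def)
  moreover have "distinct (map snd rim)"
  proof -
    have "4 - rise (Suc k) \<noteq> 4 + rise (Suc k)" if "Suc k < L" for k
      using that by (auto simp: rise_def)
    then show ?thesis
      by (auto simp: rim_def distinct_map inj_on_def)
  qed
  moreover have "rim \<noteq> []"
    using L length_rim by auto
  ultimately show ?thesis
    using walk L length_rim unfolding elementary_cycle_iff
    by (auto simp: node_def intro!: bexI[of _ "vtx 0 4"])
qed

lemma length_elementary_cycle_le:
  assumes "elementary_cycle graph p"
  shows "length p \<le> card (pverts graph)"
proof -
  have p: "distinct (map snd p)" "set p \<subseteq> parcs graph"
    using assms by (auto simp: elementary_cycle_iff)
  then have "set (map snd p) \<subseteq> pverts graph"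
    using parcs_subset by auto
  then show ?thesis
    using p(1) finite_pverts by (metis card_mono distinct_card length_map)
qed

text \<open>
  The lengths of elementary cycles are bounded by the number of vertices, so the maximum in the definition is
  taken over a finite set and is at least the length of the cycle around the unbounded face.\<close>
lemma max_face_vertices_ge: "2 * L \<le> max_face_vertices graph pos curve"
  unfolding max_face_vertices_def
proof (rule Max_ge)
  show "finite {length p |p F. F \<in> faces graph pos curve \<and> bounds_face graph curve p F}"
    using length_elementary_cycle_le
    by (intro finite_subset[OF _ finite_atMost[of "card (pverts graph)"]]) (auto simp: bounds_face_def)
  have "bounds_face graph curve rim (- silhouette)"
    using elementary_cycle_rim path_image_rim by (simp add: bounds_face_def)
  then show "2 * L \<in> {length p |p F. F \<in> faces graph pos curve \<and> bounds_face graph curve p F}"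
    using outer_face length_rim by force
qed

end

theorem mainTheorem2:
  fixes N :: nat
  shows
    "(\<exists>(G :: nat pair_pre_digraph) pos \<gamma>.
        planar_map G \<and> (\<nexists>p. hamiltonian_cycle G p) \<and> plane_embedding G pos \<gamma> \<and>
        card (faces G pos \<gamma>) > N) \<and>
     (\<exists>(G :: nat pair_pre_digraph) pos \<gamma>.
        planar_map G \<and> (\<nexists>p. hamiltonian_cycle G p) \<and> plane_embedding G pos \<gamma> \<and>
        card (edges G) > N) \<and>
     (\<exists>(G :: nat pair_pre_digraph) pos \<gamma>.
        planar_map G \<and> (\<nexists>p. hamiltonian_cycle G p) \<and> plane_embedding G pos \<gamma> \<and>
        card (pverts G) > N) \<and>
     (\<exists>(G :: nat pair_pre_digraph) pos \<gamma>.
        planar_map G \<and> (\<nexists>p. hamiltonian_cycle G p) \<and> plane_embedding G pos \<gamma> \<and>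
        max_face_vertices G pos \<gamma> > N)"
proof -
  \<comment> \<open>the number of faces is only bounded below by \<open>L - 4\<close>, which has to exceed \<open>N\<close>\<close>
  interpret three_ladders "N + 5"
    by unfold_locales simp
  have "N < card (faces graph pos curve)" "N < card (edges graph)" "N < card (pverts graph)"
    "N < max_face_vertices graph pos curve"
    using card_faces card_edges card_pverts max_face_vertices_ge by simp_all
  then show ?thesis
    using planar_map no_hamiltonian_cycle plane_embedding by blast
qed

end
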